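(* Let $m$ be a positive integer and let $A>1$. Then the positive equilibrium point $(\overline{x},\overline{y},\overline{z})=(A+1,A+1,A+1)$ of the system $$x_{n+1}=A+\frac{x_{n-m}}{z_n},\quad y_{n+1}=A+\frac{y_{n-m}}{z_n},\quad z_{n+1}=A+\frac{z_{n-m}}{y_n},\qquad n=0,1,2,\dots,$$ with positive initial values, is globally asymptotically stable.
   Context: Initial values $x_{-i},y_{-i},z_{-i}$, $i=0,1,\dots,m$, range over the positive real numbers. Let $(\overline{x},\overline{y},\overline{z})$ be an equilibrium point, i.e. a constant solution. Stable: for every $\varepsilon>0$ there exists $\delta>0$ such that for all positive initial values with $\sum_{i=-m}^{0}|x_i-\overline{x}|<\delta$, $\sum_{i=-m}^{0}|y_i-\overline{y}|<\delta$, $\sum_{i=-m}^{0}|z_i-\overline{z}|<\delta$, one has $|x_n-\overline{x}|<\varepsilon$, $|y_n-\overline{y}|<\varepsilon$, $|z_n-\overline{z}|<\varepsilon$ for all $n\in\mathbb{N}$. Global attractor: $(x_n,y_n,z_n)\to(\overline{x},\overline{y},\overline{z})$ as $n\to\infty$ for every solution with positive initial values. Globally asymptotically stable: stable and a global attractor. *)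

theory Defs
  imports "HOL-Analysis.Analysis"
begin

text \<open>
  Sequences are indexed by the integers \<open>n \<ge> -m\<close>; their values at indices below \<open>-m\<close> are
  never referred to.
\<close>

definition solves_system ::
  "nat \<Rightarrow> real \<Rightarrow> (int \<Rightarrow> real) \<Rightarrow> (int \<Rightarrow> real) \<Rightarrow> (int \<Rightarrow> real) \<Rightarrow> bool" where
  "solves_system m A x y z \<longleftrightarrow>
     (\<forall>n\<ge>0. x (n + 1) = A + x (n - int m) / z n \<and>
            y (n + 1) = A + y (n - int m) / z n \<and>
            z (n + 1) = A + z (n - int m) / y n)"

definition positive_initial_values ::
  "nat \<Rightarrow> (int \<Rightarrow> real) \<Rightarrow> (int \<Rightarrow> real) \<Rightarrow> (int \<Rightarrow> real) \<Rightarrow> bool" where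
  "positive_initial_values m x y z \<longleftrightarrow> (\<forall>i\<in>{- int m..0}. x i > 0 \<and> y i > 0 \<and> z i > 0)"

text \<open>
  For \<open>A \<ge> 0\<close> the terms of a positive solution are positive at all indices \<open>n \<ge> -m\<close>, so no
  division by zero occurs.
\<close>

definition positive_solution ::
  "nat \<Rightarrow> real \<Rightarrow> (int \<Rightarrow> real) \<Rightarrow> (int \<Rightarrow> real) \<Rightarrow> (int \<Rightarrow> real) \<Rightarrow> bool" where
  "positive_solution m A x y z \<longleftrightarrow>
     positive_initial_values m x y z \<and> solves_system m A x y z"

definition positive_equilibrium :: "nat \<Rightarrow> real \<Rightarrow> real \<times> real \<times> real \<Rightarrow> bool" where
  "positive_equilibrium m A = (\<lambda>(xb, yb, zb).
     positive_solution m A (\<lambda>_. xb) (\<lambda>_. yb) (\<lambda>_. zb))"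

definition stable :: "nat \<Rightarrow> real \<Rightarrow> real \<times> real \<times> real \<Rightarrow> bool" where
  "stable m A = (\<lambda>(xb, yb, zb).
     \<forall>\<epsilon>>0. \<exists>\<delta>>0. \<forall>x y z.
       positive_solution m A x y z \<longrightarrow>
       (\<Sum>i = - int m..0. \<bar>x i - xb\<bar>) < \<delta> \<longrightarrow>
       (\<Sum>i = - int m..0. \<bar>y i - yb\<bar>) < \<delta> \<longrightarrow>
       (\<Sum>i = - int m..0. \<bar>z i - zb\<bar>) < \<delta> \<longrightarrow>
       (\<forall>n::nat. \<bar>x (int n) - xb\<bar> < \<epsilon> \<and> \<bar>y (int n) - yb\<bar> < \<epsilon> \<and> \<bar>z (int n) - zb\<bar> < \<epsilon>))"

definition global_attractor :: "nat \<Rightarrow> real \<Rightarrow> real \<times> real \<times> real \<Rightarrow> bool" where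
  "global_attractor m A p \<longleftrightarrow>
     (\<forall>x y z. positive_solution m A x y z \<longrightarrow>
        (\<lambda>n::nat. (x (int n), y (int n), z (int n))) \<longlonglongrightarrow> p)"

definition globally_asymptotically_stable :: "nat \<Rightarrow> real \<Rightarrow> real \<times> real \<times> real \<Rightarrow> bool" where
  "globally_asymptotically_stable m A p \<longleftrightarrow> stable m A p \<and> global_attractor m A p"

end

theory Submission
  imports Defs
begin

text \<open>
  Stability holds because the box of radius \<open>e \<le> A - 1\<close> around the equilibrium is invariant.
  For attraction, all terms eventually exceed \<open>A > 1\<close>, which bounds every solution. If
  \<open>l\<^sub>y, L\<^sub>y, l\<^sub>z, L\<^sub>z\<close> are the lower and upper limits of \<open>y\<close> and \<open>z\<close>, the recursion gives
  \<open>L\<^sub>y \<le> A + L\<^sub>y / l\<^sub>z\<close> and \<open>A + l\<^sub>z / L\<^sub>y \<le> l\<^sub>z\<close>, so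
  \<open>A L\<^sub>y + l\<^sub>z \<le> L\<^sub>y l\<^sub>z \<le> A l\<^sub>z + L\<^sub>y\<close> and hence \<open>L\<^sub>y \<le> l\<^sub>z\<close>. By symmetry \<open>L\<^sub>z \<le> l\<^sub>y\<close>, so
  the four limits coincide with \<open>A + 1\<close>. The equation for \<open>x\<close> then forces \<open>x\<close> to
  converge as well.
\<close>

section \<open>Boundedness, and finite lower and upper limits\<close>

text \<open>The value \<open>A\<^sup>2 / (A - 1)\<close> is the fixed point of
  \<open>t \<mapsto> A + t / A\<close>. Any \<open>M\<close> at or above it satisfies
  \<open>A + M / A \<le> M\<close>, so a bound on the initial terms propagates in jumps of
  \<open>k\<close>.\<close>

lemma bounded_of_delayed_contraction:
  fixes u :: "nat \<Rightarrow> real"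
  assumes "A > 1" "k > 0" and rec: "\<And>n. n \<ge> N \<Longrightarrow> u (n + k) \<le> A + u n / A"
  obtains M where "\<And>n. u n \<le> M"
proof
  define M where "M = max (Max (u ` {..N+k})) (A\<^sup>2 / (A - 1))"
  have "A * A \<le> M * (A - 1)"
    using \<open>A > 1\<close> by (simp add: M_def pos_divide_le_eq[symmetric] power2_eq_square)
  then have M: "A + M / A \<le> M"
    using \<open>A > 1\<close> by (simp add: field_simps)
  fix n show "u n \<le> M"
  proof (induction n rule: less_induct)
    case (less n)
    show ?case
    proof (cases "n \<le> N + k")
      case True
      then show ?thesis by (simp add: M_def le_max_iff_disj)
    next
      case False
      then have "u n \<le> A + u (n - k) / A" using rec[of "n - k"] by simp
      also have "\<dots> \<le> A + M / A"
        using less[of "n - k"] False \<open>k > 0\<close> \<open>A > 1\<close> by (simp add: divide_right_mono)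
      finally show ?thesis using M by simp
    qed
  qed
qed

lemma real_limsup_liminf:
  fixes u :: "nat \<Rightarrow> real"
  assumes "\<And>n. u n \<le> M" "eventually (\<lambda>n. A \<le> u n) sequentially"
  obtains l L where "liminf u = ereal l" "limsup u = ereal L" "A \<le> l" "l \<le> L"
proof -
  have 1: "limsup u \<le> ereal M" by (rule Limsup_bounded) (simp add: assms)
  have 2: "ereal A \<le> liminf u" by (rule Liminf_bounded) (use assms in simp)
  have 3: "liminf u \<le> limsup u" by (simp add: Liminf_le_Limsup)
  obtain l where "liminf u = ereal l" using 1 2 3 by (cases "liminf u") auto
  moreover obtain L where "limsup u = ereal L" using 1 2 3 by (cases "limsup u") auto
  ultimately show thesis using that 2 3 by simp
qed

text \<open>
  From here on sequences are shifted to start at index \<open>0\<close>, so \<open>u n\<close> stands for the paper's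
  term of index \<open>n - m\<close>.
\<close>

lemma delayed_ratio_limits:
  fixes u v :: "nat \<Rightarrow> real"
  assumes rec: "\<And>n. u (n + m + 1) = A + u n / v (n + m)"
    and pos: "\<And>n. u n > 0" "\<And>n. v n > 0"
    and u: "liminf u = ereal lu" "limsup u = ereal Lu" "lu > 0"
    and v: "liminf v = ereal lv" "limsup v = ereal Lv" "lv > 0" "Lv > 0"
  shows "Lu \<le> A + Lu / lv" "A + lu / Lv \<le> lu"
proof -
  have uev: "\<forall>\<^sub>F n in sequentially. u n < U" if "U > Lu" for U
    using Limsup_le_iff[of sequentially u "ereal Lu"] u that
    by (auto dest: spec[of _ "ereal U"])
  have lev: "\<forall>\<^sub>F n in sequentially. U < u n" if "U < lu" for U
    using le_Liminf_iff[of "ereal lu" sequentially u] u that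
    by (auto dest: spec[of _ "ereal U"])
  have vuev: "\<forall>\<^sub>F n in sequentially. v (n + m) < U" if "U > Lv" for U
    using Limsup_le_iff[of sequentially v "ereal Lv"] v that
    by (intro sequentially_offset[of "\<lambda>n. v n < U"]) (auto dest: spec[of _ "ereal U"])
  have vlev: "\<forall>\<^sub>F n in sequentially. U < v (n + m)" if "U < lv" for U
    using le_Liminf_iff[of "ereal lv" sequentially v] v that
    by (intro sequentially_offset[of "\<lambda>n. U < v n"]) (auto dest: spec[of _ "ereal U"])
  \<comment> \<open>Slack \<open>e\<close> turns the limits into eventual bounds on terms;
    \<open>e < lv\<close> keeps the denominator positive.\<close>
  have upper: "Lu \<le> A + (Lu + e) / (lv - e)" if "0 < e" "e < lv" for e
  proof -
    have "\<forall>\<^sub>F n in sequentially. u (n + (m + 1)) \<le> A + (Lu + e) / (lv - e)"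
      using uev[of "Lu + e", simplified, OF that(1)] vlev[of "lv - e", simplified, OF that(1)]
    proof eventually_elim
      case (elim n)
      then have "u n / v (n + m) \<le> (Lu + e) / (lv - e)"
        using that pos(1)[of n] by (intro frac_le) auto
      then show ?case using rec[of n] by simp
    qed
    then have "\<forall>\<^sub>F n in sequentially. u n \<le> A + (Lu + e) / (lv - e)"
      by (rule eventually_sequentially_seg[THEN iffD1])
    then have "limsup u \<le> ereal (A + (Lu + e) / (lv - e))"
      by (intro Limsup_bounded) simp
    then show ?thesis using u by simp
  qed
  have lower: "lu \<ge> A + (lu - e) / (Lv + e)" if "0 < e" "e < lu" for e
  proof -
    have "\<forall>\<^sub>F n in sequentially. A + (lu - e) / (Lv + e) \<le> u (n + (m + 1))"
      using lev[of "lu - e", simplified, OF that(1)] vuev[of "Lv + e", simplified, OF that(1)]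
    proof eventually_elim
      case (elim n)
      then have "(lu - e) / (Lv + e) \<le> u n / v (n + m)"
        using that pos by (intro frac_le) auto
      then show ?case using rec[of n] by simp
    qed
    then have "\<forall>\<^sub>F n in sequentially. A + (lu - e) / (Lv + e) \<le> u n"
      by (rule eventually_sequentially_seg[THEN iffD1])
    then have "ereal (A + (lu - e) / (Lv + e)) \<le> liminf u"
      by (intro Liminf_bounded) simp
    then show ?thesis using u by simp
  qed
  have small: "\<forall>\<^sub>F e in at_right 0. 0 < e \<and> e < c" if "c > 0" for c :: real
    using that by (auto simp: eventually_at_right[of 0 1])
  \<comment> \<open>The slack is removed by letting \<open>e\<close> tend to 0 from the
    right.\<close>
  have "((\<lambda>e. A + (Lu + e) / (lv - e)) \<longlongrightarrow> A + (Lu + 0) / (lv - 0)) (at_right 0)"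
    using v by (intro tendsto_intros) auto
  then show "Lu \<le> A + Lu / lv"
    using tendsto_lowerbound[OF _ eventually_mono[OF small[of lv]], of _ "A + Lu / lv" Lu] upper v
    by simp
  have "((\<lambda>e. A + (lu - e) / (Lv + e)) \<longlongrightarrow> A + (lu - 0) / (Lv + 0)) (at_right 0)"
    using v by (intro tendsto_intros) auto
  then show "A + lu / Lv \<le> lu"
    using tendsto_upperbound[OF _ eventually_mono[OF small[of lu]], of _ "A + lu / Lv" lu] lower u
    by simp
qed

text \<open>Handles the equation for \<open>x\<close> once \<open>z\<close> is known to tend to
  \<open>A + 1\<close>: clearing denominators leaves
  \<open>A * L \<le> A * (A + 1) \<le> A * l\<close>.\<close>

lemma fixed_point_bounds:
  fixes A L l :: real
  assumes "A > 1" "l \<le> L" "l > 0" "L \<le> A + L / (A + 1)" "A + l / (A + 1) \<le> l"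
  shows "L = A + 1" "l = A + 1"
proof -
  have "A * L \<le> A * (A + 1)" "A * (A + 1) \<le> A * l"
    using assms by (simp_all add: field_simps)
  then have "L \<le> A + 1" "A + 1 \<le> l" using assms by simp_all
  then show "L = A + 1" "l = A + 1" using assms by auto
qed

lemma crossed_limits:
  fixes A ly Ly lz Lz :: real
  assumes "A > 1" "0 < ly" "ly \<le> Ly" "0 < lz" "lz \<le> Lz"
    and "Ly \<le> A + Ly / lz" "A + ly / Lz \<le> ly" "Lz \<le> A + Lz / ly" "A + lz / Ly \<le> lz"
  shows "ly = A + 1" "Ly = A + 1" "lz = A + 1" "Lz = A + 1"
proof -
  have le: "a \<le> b" if "a \<le> A + a / b" "A + b / a \<le> b" "0 < a" "0 < b" for a b :: real
  proof -
    \<comment> \<open>Both sides are compared with \<open>a * b\<close>, after multiplying the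
      assumptions by \<open>b\<close> and by \<open>a\<close>.\<close>
    have "A * a + b \<le> A * b + a" using that by (simp add: field_simps)
    then have "(A - 1) * a \<le> (A - 1) * b" by (simp add: algebra_simps)
    then show ?thesis using \<open>A > 1\<close> by simp
  qed
  have "Ly \<le> lz" "Lz \<le> ly" using le[of Ly lz] le[of Lz ly] assms by auto
  \<comment> \<open>The cycle \<open>Ly \<le> lz \<le> Lz \<le> ly \<le> Ly\<close>
    collapses.\<close>
  then have eq: "Ly = ly" "lz = ly" "Lz = ly" using assms by auto
  then have "ly \<le> A + 1" "A + 1 \<le> ly" using assms by auto
  then show "ly = A + 1" "Ly = A + 1" "lz = A + 1" "Lz = A + 1" using eq by auto
qed

lemma delayed_system_converges:
  fixes u v w :: "nat \<Rightarrow> real"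
  assumes "A > 1"
    and pos: "\<And>n. u n > 0 \<and> v n > 0 \<and> w n > 0"
    and rec: "\<And>n. u (n + m + 1) = A + u n / w (n + m)"
      "\<And>n. v (n + m + 1) = A + v n / w (n + m)"
      "\<And>n. w (n + m + 1) = A + w n / v (n + m)"
  shows "u \<longlonglongrightarrow> A + 1" "v \<longlonglongrightarrow> A + 1" "w \<longlonglongrightarrow> A + 1"
proof -
  have pos': "u n > 0" "v n > 0" "w n > 0" for n using pos by auto
  have ge: "a n \<ge> A"
    if "\<And>n. a (n + m + 1) = A + a n / b (n + m)" "\<And>n. a n > 0" "\<And>n. b n > 0" "n \<ge> m + 1"
    for a b :: "nat \<Rightarrow> real" and n
    using that(1)[of "n - (m + 1)"] that(2)[of "n - (m + 1)"] that(3)[of "n - 1"] that(4)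
    by simp
  have limits: "\<exists>l L. liminf a = ereal l \<and> limsup a = ereal L \<and> 0 < l \<and> l \<le> L"
    if a: "\<And>n. a (n + m + 1) = A + a n / b (n + m)" "\<And>n. a n > 0"
      and b: "\<And>n. b n > 0" "\<And>n. n \<ge> m + 1 \<Longrightarrow> b n \<ge> A" for a b :: "nat \<Rightarrow> real"
  proof -
    \<comment> \<open>The divisor \<open>b (n + m)\<close> is known to be at least \<open>A\<close>
      only from index \<open>m + 1\<close> on, hence \<open>n \<ge> 1\<close>.\<close>
    have "a (n + (m + 1)) \<le> A + a n / A" if "n \<ge> 1" for n
      using a(1)[of n] a(2)[of n] b(2)[of "n + m"] that \<open>A > 1\<close> by (simp add: frac_le less_imp_le)
    then obtain M where M: "\<And>n. a n \<le> M"
      using bounded_of_delayed_contraction[of A "m + 1" 1 a] \<open>A > 1\<close> by auto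
    have "eventually (\<lambda>n. A \<le> a n) sequentially"
      using ge[of a b] a b(1) by (auto simp: eventually_sequentially)
    with M obtain l L where "liminf a = ereal l" "limsup a = ereal L" "A \<le> l" "l \<le> L"
      by (rule real_limsup_liminf)
    then show ?thesis using \<open>A > 1\<close> by (intro exI[of _ l] exI[of _ L]) simp
  qed
  obtain lu Lu where u: "liminf u = ereal lu" "limsup u = ereal Lu" "0 < lu" "lu \<le> Lu"
    using limits[of u w, OF rec(1) pos'(1) pos'(3)
        ge[of w v, OF rec(3) pos'(3) pos'(2)]] by blast
  obtain lv Lv where v: "liminf v = ereal lv" "limsup v = ereal Lv" "0 < lv" "lv \<le> Lv"
    using limits[of v w, OF rec(2) pos'(2) pos'(3)
        ge[of w v, OF rec(3) pos'(3) pos'(2)]] by blast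
  obtain lw Lw where w: "liminf w = ereal lw" "limsup w = ereal Lw" "0 < lw" "lw \<le> Lw"
    using limits[of w v, OF rec(3) pos'(3) pos'(2)
        ge[of v w, OF rec(2) pos'(2) pos'(3)]] by blast
  have Lv: "Lv > 0" and Lw: "Lw > 0" using v w by auto
  note uw = delayed_ratio_limits[of u m A w, OF rec(1) pos'(1) pos'(3) u(1-3) w(1-3) Lw]
  note vw = delayed_ratio_limits[of v m A w, OF rec(2) pos'(2) pos'(3) v(1-3) w(1-3) Lw]
  note wv = delayed_ratio_limits[of w m A v, OF rec(3) pos'(3) pos'(2) w(1-3) v(1-3) Lv]
  \<comment> \<open>The sequences \<open>v\<close> and \<open>w\<close> form a closed subsystem, so
    their limits are settled before that of \<open>u\<close>.\<close>
  have eqs: "lv = A + 1" "Lv = A + 1" "lw = A + 1" "Lw = A + 1"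
    using crossed_limits[OF \<open>A > 1\<close> v(3,4) w(3,4) vw wv] by blast+
  moreover have "Lu = A + 1" "lu = A + 1"
    using fixed_point_bounds[OF \<open>A > 1\<close> u(4,3) uw[unfolded eqs]] by blast+
  ultimately show "u \<longlonglongrightarrow> A + 1" "v \<longlonglongrightarrow> A + 1" "w \<longlonglongrightarrow> A + 1"
    using u v w by (auto intro!: limsup_le_liminf_real)
qed

section \<open>Invariant box and positivity\<close>

text \<open>The upper bound rests on
  \<open>(1 + e) * (A + 1 - e) = A + 1 + e + e * (A - 1 - e)\<close>, whose last term is nonnegative
  exactly because \<open>e \<le> A - 1\<close>.\<close>

lemma ratio_box_invariant:
  fixes A e a b :: real
  assumes "A > 1" "0 < e" "e \<le> A - 1" "\<bar>a - (A + 1)\<bar> \<le> e" "\<bar>b - (A + 1)\<bar> \<le> e"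
  shows "\<bar>a / b - 1\<bar> \<le> e"
proof -
  have b: "b > 0" and up: "a \<le> A + 1 + e" "A + 1 - e \<le> b"
    and lo: "A + 1 - e \<le> a" "b \<le> A + 1 + e" using assms by auto
  have "a \<le> (1 + e) * (A + 1 - e)"
    using up mult_left_mono[of e "A - 1" e] assms by (simp add: algebra_simps)
  also have "\<dots> \<le> (1 + e) * b" using up assms by (intro mult_left_mono) auto
  finally have 1: "a / b \<le> 1 + e" using b by (simp add: field_simps)
  have "(1 - e) * b \<le> a"
  \<comment> \<open>For \<open>e > 1\<close> the factor \<open>1 - e\<close> is negative and cannot
    multiply the bound on \<open>b\<close>, but then the left side is at most 0 while
    \<open>a\<close> is positive.\<close>
  proof (cases "e \<le> 1")
    case True
    then have "(1 - e) * b \<le> (1 - e) * (A + 1 + e)" using lo by (intro mult_left_mono) auto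
    also have "\<dots> = A + 1 - e - (A - 1 + e) * e" by (simp add: algebra_simps)
    also have "\<dots> \<le> A + 1 - e" using assms by simp
    finally show ?thesis using lo by simp
  next
    case False
    then have "(1 - e) * b \<le> 0" using b by (intro mult_nonpos_nonneg) auto
    then show ?thesis using lo assms by linarith
  qed
  then have "1 - e \<le> a / b" using b by (simp add: field_simps)
  with 1 show ?thesis by auto
qed

lemma delayed_system_box:
  fixes u v w :: "nat \<Rightarrow> real"
  assumes "A > 1" "0 < e" "e \<le> A - 1"
    and init: "\<And>n. n \<le> m \<Longrightarrow>
      \<bar>u n - (A + 1)\<bar> \<le> e \<and> \<bar>v n - (A + 1)\<bar> \<le> e \<and> \<bar>w n - (A + 1)\<bar> \<le> e"
    and rec: "\<And>n. u (n + m + 1) = A + u n / w (n + m)"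
      "\<And>n. v (n + m + 1) = A + v n / w (n + m)"
      "\<And>n. w (n + m + 1) = A + w n / v (n + m)"
  shows "\<bar>u n - (A + 1)\<bar> \<le> e \<and> \<bar>v n - (A + 1)\<bar> \<le> e \<and> \<bar>w n - (A + 1)\<bar> \<le> e"
proof (induction n rule: less_induct)
  case (less n)
  show ?case
  proof (cases "n \<le> m")
    case False
    then obtain k where k: "n = k + m + 1" using less_eqE[of "m + 1" n] by (auto simp: ac_simps)
    note prev = less[of k] less[of "k + m"]
    show ?thesis unfolding k rec
      using prev by (auto simp: k intro!: ratio_box_invariant[OF assms(1-3)])
  qed (rule init)
qed

lemma delayed_system_pos:
  fixes u v w :: "nat \<Rightarrow> real"
  assumes "A > 0" and init: "\<And>n. n \<le> m \<Longrightarrow> u n > 0 \<and> v n > 0 \<and> w n > 0"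
    and rec: "\<And>n. u (n + m + 1) = A + u n / w (n + m)"
      "\<And>n. v (n + m + 1) = A + v n / w (n + m)"
      "\<And>n. w (n + m + 1) = A + w n / v (n + m)"
  shows "u n > 0 \<and> v n > 0 \<and> w n > 0"
proof (induction n rule: less_induct)
  case (less n)
  show ?case
  proof (cases "n \<le> m")
    case False
    then obtain k where k: "n = k + m + 1" using less_eqE[of "m + 1" n] by (auto simp: ac_simps)
    note prev = less[of k] less[of "k + m"]
    show ?thesis unfolding k rec
      using prev \<open>A > 0\<close> by (simp add: k add_pos_pos)
  qed (rule init)
qed

section \<open>Equilibrium, stability and attraction for integer-indexed solutions\<close>

lemma solves_system_shift:
  assumes "solves_system m A x y z"
  shows "x (int (n + m + 1) - int m) = A + x (int n - int m) / z (int (n + m) - int m)"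
    and "y (int (n + m + 1) - int m) = A + y (int n - int m) / z (int (n + m) - int m)"
    and "z (int (n + m + 1) - int m) = A + z (int n - int m) / y (int (n + m) - int m)"
  using assms[unfolded solves_system_def, rule_format, of "int n"] by (simp_all add: add.commute)

text \<open>A constant solution is its own lower and upper limit, so the inequalities used for
  attraction also give uniqueness.\<close>

lemma positive_equilibrium_iff:
  assumes "A > 1"
  shows "positive_equilibrium m A p \<longleftrightarrow> p = (A + 1, A + 1, A + 1)"
proof -
  obtain a b c where p: "p = (a, b, c)" by (cases p) auto
  have "positive_equilibrium m A p \<longleftrightarrow>
      a > 0 \<and> b > 0 \<and> c > 0 \<and> a = A + a / c \<and> b = A + b / c \<and> c = A + c / b"
    by (auto simp: p positive_equilibrium_def positive_solution_def
        positive_initial_values_def solves_system_def)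
  also have "\<dots> \<longleftrightarrow> a = A + 1 \<and> b = A + 1 \<and> c = A + 1"
  proof
    assume *: "a > 0 \<and> b > 0 \<and> c > 0 \<and> a = A + a / c \<and> b = A + b / c \<and> c = A + c / b"
    then have le: "a \<le> A + a / c" "A + a / c \<le> a" "b \<le> A + b / c" "A + b / c \<le> b"
        "c \<le> A + c / b" "A + c / b \<le> c" by linarith+
    have "b = A + 1" and c: "c = A + 1"
      using crossed_limits[of A b b c c, OF assms _ order_refl _ order_refl] * le by blast+
    moreover have "a = A + 1"
      using fixed_point_bounds[of A a a, OF assms order_refl _ le(1,2)[unfolded c]] * by blast
    ultimately show "a = A + 1 \<and> b = A + 1 \<and> c = A + 1" by blast
  qed (use assms in auto)
  finally show ?thesis by (simp add: p)
qed

lemma stable_equilibrium: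
  assumes "A > 1"
  shows "stable m A (A + 1, A + 1, A + 1)"
  unfolding stable_def prod.case
proof (intro allI impI)
  fix \<epsilon> :: real assume "\<epsilon> > 0"
  \<comment> \<open>The cap \<open>A - 1\<close> makes the box invariant; halving
    \<open>\<epsilon>\<close> makes the final bound strict. The same \<open>e\<close> serves as
    \<open>\<delta>\<close>, since each initial deviation is at most the sum.\<close>
  define e where "e = min (\<epsilon> / 2) (A - 1)"
  have e: "0 < e" "e \<le> A - 1" "e < \<epsilon>" using \<open>\<epsilon> > 0\<close> assms by (auto simp: e_def)
  have "\<bar>x (int n) - (A + 1)\<bar> < \<epsilon> \<and> \<bar>y (int n) - (A + 1)\<bar> < \<epsilon> \<and> \<bar>z (int n) - (A + 1)\<bar> < \<epsilon>"
    if sol: "positive_solution m A x y z"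
      and close: "(\<Sum>i = - int m..0. \<bar>x i - (A + 1)\<bar>) < e"
        "(\<Sum>i = - int m..0. \<bar>y i - (A + 1)\<bar>) < e"
        "(\<Sum>i = - int m..0. \<bar>z i - (A + 1)\<bar>) < e" for x y z and n :: nat
  proof -
    have sys: "solves_system m A x y z" using sol by (simp add: positive_solution_def)
    have init: "\<bar>f (int k - int m) - (A + 1)\<bar> \<le> e"
      if "(\<Sum>i = - int m..0. \<bar>f i - (A + 1)\<bar>) < e" "k \<le> m" for f :: "int \<Rightarrow> real" and k
    proof -
      have "\<bar>f (int k - int m) - (A + 1)\<bar> \<le> (\<Sum>i = - int m..0. \<bar>f i - (A + 1)\<bar>)"
        using that by (intro member_le_sum) auto
      then show ?thesis using that by simp
    qed
    show ?thesis
      using delayed_system_box[of A e m "\<lambda>n. x (int n - int m)" "\<lambda>n. y (int n - int m)"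
          "\<lambda>n. z (int n - int m)" "n + m", OF assms e(1,2) _ solves_system_shift[OF sys]]
        init close e by auto
  qed
  then show "\<exists>\<delta>>0. \<forall>x y z. positive_solution m A x y z \<longrightarrow>
      (\<Sum>i = - int m..0. \<bar>x i - (A + 1)\<bar>) < \<delta> \<longrightarrow>
      (\<Sum>i = - int m..0. \<bar>y i - (A + 1)\<bar>) < \<delta> \<longrightarrow>
      (\<Sum>i = - int m..0. \<bar>z i - (A + 1)\<bar>) < \<delta> \<longrightarrow>
      (\<forall>n::nat. \<bar>x (int n) - (A + 1)\<bar> < \<epsilon> \<and> \<bar>y (int n) - (A + 1)\<bar> < \<epsilon> \<and>
        \<bar>z (int n) - (A + 1)\<bar> < \<epsilon>)"
    using e(1) by blast
qed

lemma global_attractor_equilibrium: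
  assumes "A > 1"
  shows "global_attractor m A (A + 1, A + 1, A + 1)"
  unfolding global_attractor_def
proof (intro allI impI)
  fix x y z assume sol: "positive_solution m A x y z"
  then have sys: "solves_system m A x y z" by (simp add: positive_solution_def)
  have init: "x (int n - int m) > 0 \<and> y (int n - int m) > 0 \<and> z (int n - int m) > 0"
    if "n \<le> m" for n
    using sol that by (auto simp: positive_solution_def positive_initial_values_def)
  have pos: "x (int n - int m) > 0 \<and> y (int n - int m) > 0 \<and> z (int n - int m) > 0" for n
    using delayed_system_pos[of A m "\<lambda>n. x (int n - int m)" "\<lambda>n. y (int n - int m)"
        "\<lambda>n. z (int n - int m)", OF _ init solves_system_shift[OF sys]] assms
    by simp
  note lim = delayed_system_converges[of A "\<lambda>n. x (int n - int m)" "\<lambda>n. y (int n - int m)"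
      "\<lambda>n. z (int n - int m)" m, OF assms pos solves_system_shift[OF sys]]
  show "(\<lambda>n::nat. (x (int n), y (int n), z (int n))) \<longlonglongrightarrow> (A + 1, A + 1, A + 1)"
    \<comment> \<open>Dropping the first \<open>m\<close> shifted terms restores the original index
      \<open>int n\<close>.\<close>
    using lim[THEN LIMSEQ_ignore_initial_segment, of m] by (auto intro!: tendsto_Pair)
qed

theorem theorem3p8:
  fixes m :: nat and A :: real
  assumes "m > 0" and "A > 1"
  shows "(\<forall>p. positive_equilibrium m A p \<longleftrightarrow> p = (A + 1, A + 1, A + 1)) \<and>
         globally_asymptotically_stable m A (A + 1, A + 1, A + 1)"
  using assms positive_equilibrium_iff stable_equilibrium global_attractor_equilibrium
  by (simp add: globally_asymptotically_stable_def)

end
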